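(* Let $\alpha,\beta$ be non-negative integers with $n=2^{\alpha}3^{\beta}>12$ and $n\ne 24$. Then $$\varphi_{12}(n)=\begin{cases} \frac12\left(3^{\beta-2}-(-1)^{\alpha+\beta}\right), & \text{if } \alpha=0, \text{ or } \alpha=1 \text{ and } \beta\ge 2;\\[2pt] 2^{\alpha-2}\cdot 3^{\beta-2}, & \text{if } \alpha\ge 2 \text{ and } \beta\ge 2;\\[2pt] \frac13\left(2^{\alpha+\beta-3}+(-1)^{\alpha+\beta}\right), & \text{if } \alpha\ge 4 \text{ and } \beta\in\{0,1\}. \end{cases}$$
   Context: For positive integers $n,e$, the generalized Euler function is $\varphi_e(n)=\#\{i\in\mathbb{Z}: 1\le i\le \lfloor n/e\rfloor,\ \gcd(i,n)=1\}$, where $\lfloor x\rfloor$ is the greatest integer not exceeding $x$. *)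

theory Defs
  imports Complex_Main
begin

text \<open>The generalized Euler function \<open>\<phi>\<^sub>e(n)\<close>, for positive \<open>e\<close> and \<open>n\<close>.\<close>

definition gen_totient :: "nat \<Rightarrow> nat \<Rightarrow> nat" where
  "gen_totient e n =
     card {i :: int. 1 \<le> i \<and> i \<le> \<lfloor>real n / real e\<rfloor> \<and> gcd i (int n) = 1}"

end

theory Submission
  imports Defs "HOL-Computational_Algebra.Primes"
begin

text \<open>Being coprime to \<open>2\<^sup>\<alpha> 3\<^sup>\<beta>\<close> only depends on which of the exponents vanish, so \<open>\<phi>\<^sub>1\<^sub>2(n)\<close>
  counts the integers up to \<open>m = \<lfloor>n/12\<rfloor>\<close> that avoid the multiples of 2, of 3, or of both,
  which is a quasi-linear function of \<open>m\<close>. The signs in the formulas come from the residues of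
  \<open>3\<^sup>k\<close> modulo 4 and of \<open>2\<^sup>k\<close> modulo 3, which determine the residue of \<open>m\<close>.\<close>

text \<open>Trades the integers and the real floor for \<open>nat\<close> and \<open>div\<close>, so
  that counts can be proved by induction on the bound.\<close>

lemma gen_totient_eq_card_nat:
  "gen_totient e n = card {i \<in> {1..n div e}. coprime i n}"
proof -
  have floor: "\<lfloor>real n / real e\<rfloor> = int (n div e)"
    by (rule floor_divide_of_nat_eq)
  have "{i :: int. 1 \<le> i \<and> i \<le> \<lfloor>real n / real e\<rfloor> \<and> gcd i (int n) = 1}
      = int ` {i \<in> {1..n div e}. coprime i n}" (is "?L = ?R")
  proof
    show "?R \<subseteq> ?L"
      unfolding floor by (auto simp: coprime_iff_gcd_eq_1[symmetric])
    show "?L \<subseteq> ?R"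
    proof
      fix i assume "i \<in> ?L"
      then show "i \<in> ?R"
        unfolding floor
        by (cases i rule: int_cases4) (auto simp: coprime_iff_gcd_eq_1[symmetric])
    qed
  qed
  then show ?thesis
    unfolding gen_totient_def by (simp add: card_image)
qed

lemma coprime_3_iff: "coprime i 3 \<longleftrightarrow> \<not> 3 dvd i" for i :: nat
proof
  assume "coprime i 3"
  then show "\<not> 3 dvd i"
    by (metis coprime_absorb_right numeral_eq_one_iff nat_dvd_1_iff_1 semiring_norm(86))
next
  assume "\<not> 3 dvd i"
  moreover have "prime (3 :: nat)"
    by simp
  ultimately show "coprime i 3"
    by (metis coprime_commute prime_imp_coprime)
qed

lemma coprime_2_power_3_power_iff:
  "coprime i (2 ^ a * 3 ^ b) \<longleftrightarrow> (a = 0 \<or> odd i) \<and> (b = 0 \<or> \<not> 3 dvd i)" for i :: nat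
  by (auto simp: coprime_3_iff)

lemma card_filter_atLeastAtMost_Suc:
  "card {i \<in> {1..Suc m}. P i} = card {i \<in> {1..m}. P i} + (if P (Suc m) then 1 else 0)"
proof -
  have "{i \<in> {1..Suc m}. P i} = {i \<in> {1..m}. P i} \<union> (if P (Suc m) then {Suc m} else {})"
    by (auto simp: le_Suc_eq)
  then show ?thesis
    by (auto simp: card_insert_if)
qed

lemma card_odd: "card {i \<in> {1..m}. odd i} = (m + 1) div 2"
proof (induction m)
  case (Suc m)
  then show ?case
    unfolding card_filter_atLeastAtMost_Suc by presburger
qed simp

lemma card_not_3_dvd: "card {i \<in> {1..m}. \<not> 3 dvd i} = m - m div 3"
proof (induction m)
  case (Suc m)
  then show ?case
    unfolding card_filter_atLeastAtMost_Suc
    by (auto simp: div_Suc dvd_eq_mod_eq_0 Suc_diff_le)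
qed simp

text \<open>The integers in question are those congruent to 1 or 5 modulo 6; up to \<open>m\<close>
  there are \<open>(m + 5) div 6\<close> of the first kind and \<open>(m + 1) div 6\<close> of the
  second.\<close>

lemma card_odd_not_3_dvd:
  "card {i \<in> {1..m}. odd i \<and> \<not> 3 dvd i} = (m + 5) div 6 + (m + 1) div 6"
proof (induction m)
  case (Suc m)
  \<comment> \<open>Residues 0 and 4 of \<open>m\<close> make \<open>Suc m\<close> congruent to 1
    and 5; each of them raises exactly one of the two quotients.\<close>
  have "odd (Suc m) \<and> \<not> 3 dvd Suc m \<longleftrightarrow> m mod 6 = 0 \<or> m mod 6 = 4"
    by presburger
  moreover have "(Suc m + 5) div 6 = (m + 5) div 6 + (if m mod 6 = 0 then 1 else 0)"
  proof -
    have "Suc (m + 5) mod 6 = m mod 6"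
      using mod_add_self2[of m 6] by (simp only: add_Suc_right[symmetric]) simp
    then show ?thesis
      using div_Suc[of "m + 5" 6] by (cases "m mod 6 = 0") simp_all
  qed
  moreover have "(Suc m + 1) div 6 = (m + 1) div 6 + (if m mod 6 = 4 then 1 else 0)"
    by (auto simp: div_Suc mod_Suc)
  ultimately show ?case
    unfolding card_filter_atLeastAtMost_Suc Suc.IH by simp
qed simp

lemma gen_totient_2_power_3_power:
  assumes "n = 2 ^ a * 3 ^ b"
  shows "a = 0 \<Longrightarrow> b > 0 \<Longrightarrow> gen_totient e n = n div e - n div e div 3"
    and "a > 0 \<Longrightarrow> b = 0 \<Longrightarrow> gen_totient e n = (n div e + 1) div 2"
    and "a > 0 \<Longrightarrow> b > 0 \<Longrightarrow>
          gen_totient e n = (n div e + 5) div 6 + (n div e + 1) div 6"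
  unfolding gen_totient_eq_card_nat assms coprime_2_power_3_power_iff
  by (simp_all add: card_odd[simplified] card_not_3_dvd[simplified] card_odd_not_3_dvd[simplified])

lemma power_3_mod_4: "3 ^ k mod 4 = (if even k then 1 else 3 :: nat)"
proof (induction k)
  case (Suc k)
  then show ?case
    by simp presburger
qed simp

lemma power_2_mod_3: "2 ^ k mod 3 = (if even k then 1 else 2 :: nat)"
proof (induction k)
  case (Suc k)
  then show ?case
    by simp presburger
qed simp

text \<open>With \<open>3 ^ k = 4 * q + r\<close> and \<open>r\<close> equal to 1 or 3, both sides
  become linear in \<open>q\<close>; the sign on the right absorbs the dependence on
  \<open>r\<close>.\<close>

lemma gen_totient_12_power_3:
  assumes "a \<le> 1"
  shows "real (gen_totient 12 (2 ^ a * 3 ^ (k + 2))) = 1 / 2 * (3 ^ k - (-1) ^ (a + k))"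
proof -
  define r :: nat where "r = (if even k then 1 else 3)"
  define q where "q = 3 ^ k div (4 :: nat)"
  have eq: "(3 :: nat) ^ k = 4 * q + r"
    unfolding q_def r_def power_3_mod_4[symmetric] by simp
  then have n: "(3 :: nat) ^ (k + 2) = 36 * q + 9 * r"
    by (simp add: power_add)
  have pow: "3 ^ k = 4 * real q + real r"
    using arg_cong[OF eq, of real] by simp
  note tot = gen_totient_2_power_3_power[of _ a "k + 2" 12, OF refl]
  consider "a = 0" | "a = 1"
    using assms by linarith
  then show ?thesis
  proof cases
    case 1
    \<comment> \<open>The remainder part \<open>9 * r\<close> is 9 or 27, which contributes 0 or 2
      to the quotient by 12.\<close>
    have "(36 * q + 9 * r) div 12 = 3 * q + (if even k then 0 else 2)"
      unfolding r_def by (rule div_nat_eqI) auto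
    moreover have "(3 * q + 2) div 3 = q"
      by (rule div_nat_eqI) auto
    ultimately have "gen_totient 12 (2 ^ a * 3 ^ (k + 2)) = 2 * q + (if even k then 0 else 2)"
      using tot(1) 1 unfolding n by simp
    then show ?thesis
      using 1 by (auto simp: pow r_def)
  next
    case 2
    have "2 * (36 * q + 9 * r) div 12 = 6 * q + (if even k then 1 else 4)"
      unfolding r_def by (rule div_nat_eqI) auto
    \<comment> \<open>The bounds \<open>6 * q + 1\<close> and \<open>6 * q + 4\<close> give the same
      count, since none of 2, 3, 4 is coprime to 6.\<close>
    moreover have "(6 * q + 4 + 5) div 6 = q + 1" "(6 * q + 4 + 1) div 6 = q"
      "(6 * q + 1 + 5) div 6 = q + 1" "(6 * q + 1 + 1) div 6 = q"
      by (rule div_nat_eqI; simp)+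
    ultimately have "gen_totient 12 (2 ^ a * 3 ^ (k + 2)) = 2 * q + 1"
      using tot(3) 2 unfolding n by simp
    then show ?thesis
      using 2 by (auto simp: pow r_def)
  qed
qed

lemma gen_totient_12_mult_36:
  "gen_totient 12 (2 ^ (a + 2) * 3 ^ (b + 2)) = 2 ^ a * 3 ^ b"
proof -
  have n: "2 ^ (a + 2) * 3 ^ (b + 2) = 36 * (2 ^ a * 3 ^ b :: nat)"
    by (simp add: power_add)
  \<comment> \<open>Here \<open>n div 12 = 3 * x\<close>. Each block \<open>3 * j + 1\<close>,
    \<open>3 * j + 2\<close>, \<open>3 * j + 3\<close> holds exactly one number coprime to 6, namely
    the odd one among the first two.\<close>
  have "(3 * x + 5) div 6 + (3 * x + 1) div 6 = x" for x :: nat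
  proof (cases "even x")
    case True
    then obtain y where "x = 2 * y"
      by blast
    moreover have "(6 * y + 5) div 6 = y" "(6 * y + 1) div 6 = y"
      by (rule div_nat_eqI; simp)+
    ultimately show ?thesis
      by simp
  next
    case False
    then obtain y where "x = 2 * y + 1"
      by (rule oddE)
    moreover have "(6 * y + 8) div 6 = y + 1" "(6 * y + 4) div 6 = y"
      by (rule div_nat_eqI; simp)+
    ultimately show ?thesis
      by (simp add: algebra_simps)
  qed
  then show ?thesis
    using gen_totient_2_power_3_power(3)[of _ "a + 2" "b + 2" 12, OF refl] unfolding n by simp
qed

text \<open>Same method with \<open>2 ^ a = 3 * q + r\<close>, where \<open>r\<close> is 1 or 2.
  Taking \<open>\<alpha> = a + 4\<close> turns the exponent \<open>\<alpha> + \<beta> - 3\<close>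
  into \<open>a + b + 1\<close> and keeps the sign.\<close>

lemma gen_totient_12_power_2:
  assumes "b \<le> 1"
  shows "real (gen_totient 12 (2 ^ (a + 4) * 3 ^ b)) = 1 / 3 * (2 ^ (a + b + 1) + (-1) ^ (a + b))"
proof -
  define r :: nat where "r = (if even a then 1 else 2)"
  define q where "q = 2 ^ a div (3 :: nat)"
  have eq: "(2 :: nat) ^ a = 3 * q + r"
    unfolding q_def r_def power_2_mod_3[symmetric] by simp
  then have n: "(2 :: nat) ^ (a + 4) = 48 * q + 16 * r"
    by (simp add: power_add)
  have pow: "2 ^ a = 3 * real q + real r"
    using arg_cong[OF eq, of real] by simp
  note tot = gen_totient_2_power_3_power[of _ "a + 4" b 12, OF refl]
  consider "b = 0" | "b = 1"
    using assms by linarith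
  then show ?thesis
  proof cases
    case 1
    have "(48 * q + 16 * r) div 12 = 4 * q + r"
      unfolding r_def by (rule div_nat_eqI) auto
    \<comment> \<open>For \<open>r = 2\<close> the extra integer \<open>4 * q + 2\<close> is even,
      so both values of \<open>r\<close> give the same count.\<close>
    moreover have "(4 * q + r + 1) div 2 = 2 * q + 1"
      unfolding r_def by (rule div_nat_eqI) auto
    ultimately have "gen_totient 12 (2 ^ (a + 4) * 3 ^ b) = 2 * q + 1"
      using tot(2) 1 unfolding n by simp
    then show ?thesis
      using 1 by (auto simp: pow r_def)
  next
    case 2
    have "(48 * q + 16 * r) * 3 div 12 = 12 * q + 4 * r"
      unfolding r_def by (rule div_nat_eqI) auto
    moreover have "(12 * q + 4 * r + 5) div 6 = 2 * q + r"
      "(12 * q + 4 * r + 1) div 6 = 2 * q + (if even a then 0 else 1)"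
      unfolding r_def by (rule div_nat_eqI; auto)+
    ultimately have "gen_totient 12 (2 ^ (a + 4) * 3 ^ b) = 4 * q + (if even a then 1 else 3)"
      using tot(3) 2 unfolding n by (simp add: r_def)
    then show ?thesis
      using 2 by (auto simp: pow r_def)
  qed
qed

theorem theorem4p1:
  fixes \<alpha> \<beta> n :: nat
  assumes "n = 2 ^ \<alpha> * 3 ^ \<beta>" and "n > 12" and "n \<noteq> 24"
  shows "(\<alpha> = 0 \<or> (\<alpha> = 1 \<and> \<beta> \<ge> 2) \<longrightarrow>
            real (gen_totient 12 n) = 1 / 2 * (3 powi (int \<beta> - 2) - (-1) ^ (\<alpha> + \<beta>))) \<and>
         (\<alpha> \<ge> 2 \<and> \<beta> \<ge> 2 \<longrightarrow>
            real (gen_totient 12 n) = 2 powi (int \<alpha> - 2) * 3 powi (int \<beta> - 2)) \<and>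
         (\<alpha> \<ge> 4 \<and> \<beta> \<in> {0, 1} \<longrightarrow>
            real (gen_totient 12 n) = 1 / 3 * (2 powi (int \<alpha> + int \<beta> - 3) + (-1) ^ (\<alpha> + \<beta>)))"
proof (intro conjI impI)
  assume *: "\<alpha> = 0 \<or> (\<alpha> = 1 \<and> \<beta> \<ge> 2)"
  \<comment> \<open>A power of 3 above 12 is at least 27. Hence \<open>int \<beta> - 2\<close> is
    non-negative and \<open>powi\<close> becomes an ordinary power.\<close>
  have "\<beta> \<ge> 2" if "\<alpha> = 0"
  proof (rule ccontr)
    assume "\<not> \<beta> \<ge> 2"
    then have "(3 :: nat) ^ \<beta> \<le> 3 ^ 1"
      by (intro power_increasing) auto
    then show False
      using assms that by simp
  qed
  with * have "\<beta> \<ge> 2" "\<alpha> \<le> 1"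
    by auto
  moreover from this obtain k where "\<beta> = k + 2"
    by (metis le_add_diff_inverse2)
  ultimately show "real (gen_totient 12 n) = 1 / 2 * (3 powi (int \<beta> - 2) - (-1) ^ (\<alpha> + \<beta>))"
    using gen_totient_12_power_3[of \<alpha> k] by (simp add: assms(1))
next
  assume "\<alpha> \<ge> 2 \<and> \<beta> \<ge> 2"
  then obtain a b where "\<alpha> = a + 2" "\<beta> = b + 2"
    by (metis le_add_diff_inverse2)
  then show "real (gen_totient 12 n) = 2 powi (int \<alpha> - 2) * 3 powi (int \<beta> - 2)"
    using gen_totient_12_mult_36[of a b] by (simp add: assms(1))
next
  assume *: "\<alpha> \<ge> 4 \<and> \<beta> \<in> {0, 1}"
  then obtain a where a: "\<alpha> = a + 4"
    by (metis le_add_diff_inverse2)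
  \<comment> \<open>Exhibits the integer exponent as the image of a natural number, as
    \<open>power_int_of_nat\<close> requires.\<close>
  have "int \<alpha> + int \<beta> - 3 = int (a + \<beta> + 1)"
    using a by simp
  then have "2 powi (int \<alpha> + int \<beta> - 3) = (2 :: real) ^ (a + \<beta> + 1)"
    by (simp only: power_int_of_nat)
  then show "real (gen_totient 12 n) =
      1 / 3 * (2 powi (int \<alpha> + int \<beta> - 3) + (-1) ^ (\<alpha> + \<beta>))"
    using gen_totient_12_power_2[of \<beta> a] * by (auto simp: assms(1) a power_add)
qed

end
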